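(* Let $\mathscr{M}$ be a homogeneous and monotone mean defined on $\mathbb{R}_+$. Suppose there exists a sequence $(a_n)_{n=1}^\infty$ of positive numbers such that (1) $\sum_{n=1}^\infty a_n=+\infty$; (2) the sequence $\big(a_n^{-1}\mathscr{M}(a_1,\dots,a_n)\big)_{n=1}^\infty$ is nearly increasing and divergent; (3) $\sum_{n=1}^\infty a_n^{1+s}\,\big(\mathscr{M}(a_1,\dots,a_n)\big)^{-s}$ is finite for some $s\in\mathbb{R}_+$. Then $\mathscr{M}$ is not a weak-Hardy mean.
   Context: $\mathbb{R}_+=(0,+\infty)$. A mean on an interval $I\subset[0,+\infty)$ is a function $\mathscr{M}\colon\bigcup_{n=1}^\infty I^n\to I$ with $\min(a)\le\mathscr{M}(a)\le\max(a)$ for every vector $a$. It is monotone if for each $n$ the restriction $\mathscr{M}|_{I^n}$ is nondecreasing in each variable. A mean on $\mathbb{R}_+$ is homogeneous if $\mathscr{M}(ta_1,\dots,ta_n)=t\,\mathscr{M}(a_1,\dots,a_n)$ for all $t>0$, $n\in\mathbb{N}$ and $(a_1,\dots,a_n)\in\mathbb{R}_+^n$. $\ell_1(I)$ denotes the set of summable sequences with all terms in $I$. A mean $\mathscr{M}$ on $I$ is a weak-Hardy mean if $\sum_{n=1}^\infty \mathscr{M}(a_1,\dots,a_n)<+\infty$ for all $a\in\ell_1(I)$. A sequence $(c_n)$ of positive numbers is nearly increasing if there exists $\varepsilon>0$ such that $\varepsilon c_m\le c_n$ for all $m,n\in\mathbb{N}$ with $m\le n$. "Divergent" here means tending to $+\infty$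 (for a nearly increasing sequence this is the same as being unbounded). *)

theory Defs
  imports "HOL-Analysis.Analysis"
begin

text \<open>
  A vector in the union of the powers \<open>I\<^sup>n\<close> with \<open>n \<ge> 1\<close> is a nonempty list over \<open>I\<close>.
  The value of a mean at any other list is left unconstrained.
\<close>

definition vectors :: "real set \<Rightarrow> real list set" where
  "vectors I = {xs. xs \<noteq> [] \<and> set xs \<subseteq> I}"

definition mean_on :: "real set \<Rightarrow> (real list \<Rightarrow> real) \<Rightarrow> bool" where
  "mean_on I M \<longleftrightarrow>
     is_interval I \<and> I \<subseteq> {0..} \<and>
     (\<forall>xs\<in>vectors I. M xs \<in> I \<and> Min (set xs) \<le> M xs \<and> M xs \<le> Max (set xs))"

definition monotone_mean_on :: "real set \<Rightarrow> (real list \<Rightarrow> real) \<Rightarrow> bool" where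
  "monotone_mean_on I M \<longleftrightarrow>
     (\<forall>xs\<in>vectors I. \<forall>i<length xs. \<forall>y\<in>I. xs ! i \<le> y \<longrightarrow> M xs \<le> M (xs[i := y]))"

definition homogeneous_mean :: "(real list \<Rightarrow> real) \<Rightarrow> bool" where
  "homogeneous_mean M \<longleftrightarrow>
     (\<forall>t>0. \<forall>xs\<in>vectors {0<..}. M (map (\<lambda>x. t * x) xs) = t * M xs)"

text \<open>
  Sequences are indexed from 0, so \<open>a n\<close> stands for \<open>a\<^sub>n\<^sub>+\<^sub>1\<close>, and \<open>mean_seq M a n\<close> is the mean of
  \<open>a 0, \<dots>, a n\<close>.
\<close>

definition mean_seq :: "(real list \<Rightarrow> real) \<Rightarrow> (nat \<Rightarrow> real) \<Rightarrow> nat \<Rightarrow> real" where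
  "mean_seq M a n = M (map a [0..<Suc n])"

text \<open>
  For a mean on \<open>I \<subseteq> {0..}\<close> all the terms below are nonnegative, so a sum is finite exactly if the
  series is \<^const>\<open>summable\<close>.
\<close>

definition weak_Hardy_on :: "real set \<Rightarrow> (real list \<Rightarrow> real) \<Rightarrow> bool" where
  "weak_Hardy_on I M \<longleftrightarrow>
     (\<forall>a. (\<forall>n. a n \<in> I) \<and> summable a \<longrightarrow> summable (mean_seq M a))"

definition nearly_increasing :: "(nat \<Rightarrow> real) \<Rightarrow> bool" where
  "nearly_increasing c \<longleftrightarrow>
     (\<forall>n. c n > 0) \<and> (\<exists>\<epsilon>>0. \<forall>m n. m \<le> n \<longrightarrow> \<epsilon> * c m \<le> c n)"

end

theory Submission
  imports Defs
begin

text \<open>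
  Put \<open>c\<^sub>n = M(a\<^sub>1, \<dots>, a\<^sub>n) / a\<^sub>n\<close>. By (3) the series of \<open>a\<^sub>n c\<^sub>n\<^sup>-\<^sup>s\<close> converges, while by (1) and (2)
  that of \<open>a\<^sub>n c\<^sub>n\<^sup>u\<close> diverges for every \<open>u \<ge> 0\<close>. Raising the exponent from \<open>-s\<close> in unit steps, we
  find \<open>t > 0\<close> such that the series of \<open>a\<^sub>n c\<^sub>n\<^sup>-\<^sup>t\<close> converges but that of \<open>a\<^sub>n c\<^sub>n\<^sup>1\<^sup>-\<^sup>t\<close> diverges. The
  sequence \<open>b\<^sub>n = a\<^sub>n c\<^sub>n\<^sup>-\<^sup>t\<close> is then a counterexample to the weak-Hardy property: since \<open>c\<close> is nearly
  increasing, \<open>b\<^sub>k \<ge> \<epsilon>\<^sup>t c\<^sub>n\<^sup>-\<^sup>t a\<^sub>k\<close> for \<open>k \<le> n\<close>, whence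
  \<open>M(b\<^sub>1, \<dots>, b\<^sub>n) \<ge> \<epsilon>\<^sup>t c\<^sub>n\<^sup>-\<^sup>t M(a\<^sub>1, \<dots>, a\<^sub>n) = \<epsilon>\<^sup>t a\<^sub>n c\<^sub>n\<^sup>1\<^sup>-\<^sup>t\<close>.
\<close>

text \<open>Entries of \<open>xs\<close> are exchanged for those of \<open>ys\<close> one at a time
  from the left; every intermediate vector still lies over \<open>I\<close>, so monotonicity in a
  single variable applies.\<close>

lemma monotone_mean_on_list_all2:
  assumes "monotone_mean_on I M" "xs \<in> vectors I" "ys \<in> vectors I" "list_all2 (\<le>) xs ys"
  shows "M xs \<le> M ys"
proof -
  have len: "length xs = length ys"
    using assms(4) by (rule list_all2_lengthD)
  have "M xs \<le> M (take k ys @ drop k xs)" if "k \<le> length xs" for k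
    using that
  proof (induction k)
    case 0
    then show ?case by simp
  next
    case (Suc k)
    let ?zs = "take k ys @ drop k xs"
    have k: "k < length xs" using Suc.prems by simp
    have "set ?zs \<subseteq> I"
      using assms(2,3) set_take_subset[of k ys] set_drop_subset[of k xs]
      unfolding vectors_def by auto
    then have "?zs \<in> vectors I"
      using k unfolding vectors_def by auto
    moreover have "?zs ! k = xs ! k" "k < length ?zs"
      using k len by (auto simp: nth_append)
    moreover have "xs ! k \<le> ys ! k"
      using assms(4) k by (rule list_all2_nthD)
    moreover have "ys ! k \<in> I"
      using assms(3) k len unfolding vectors_def by auto
    ultimately have "M ?zs \<le> M (?zs[k := ys ! k])"
      using assms(1) unfolding monotone_mean_on_def by auto
    also have "?zs[k := ys ! k] = take (Suc k) ys @ drop (Suc k) xs"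
      using k len
      by (simp add: list_update_append take_Suc_conv_app_nth Cons_nth_drop_Suc[symmetric])
    finally show ?case
      using Suc.IH k by simp
  qed
  from this[of "length xs"] show ?thesis
    using len by simp
qed

text \<open>Homogeneity moves \<open>r\<close> inside the mean, where monotonicity compares the
  entries. The bound is asked only up to \<open>n\<close>, so that \<open>r\<close> may depend on
  \<open>n\<close> in applications.\<close>

lemma mean_seq_scaled_le:
  assumes hom: "homogeneous_mean M" and mono: "monotone_mean_on {0<..} M"
    and pos: "\<And>k. 0 < a k" and r: "0 < r" and le: "\<And>k. k \<le> n \<Longrightarrow> r * a k \<le> b k"
  shows "r * mean_seq M a n \<le> mean_seq M b n"
proof -
  let ?xs = "map a [0..<Suc n]"
  have xs: "?xs \<in> vectors {0<..}"
    using pos unfolding vectors_def by auto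
  have b_pos: "0 < b k" if "k \<le> n" for k
    using le[OF that] mult_pos_pos[OF r pos[of k]] by linarith
  have "r * M ?xs = M (map (\<lambda>x. r * x) ?xs)"
    using hom r xs unfolding homogeneous_mean_def by (simp del: upt_Suc map_map)
  also have "\<dots> \<le> M (map b [0..<Suc n])"
  proof (rule monotone_mean_on_list_all2[OF mono])
    show "map (\<lambda>x. r * x) ?xs \<in> vectors {0<..}"
      using pos r unfolding vectors_def by (auto simp del: upt_Suc)
    show "map b [0..<Suc n] \<in> vectors {0<..}"
      using b_pos unfolding vectors_def by (auto simp: less_Suc_eq_le simp del: upt_Suc)
    show "list_all2 (\<le>) (map (\<lambda>x. r * x) ?xs) (map b [0..<Suc n])"
      using le by (auto simp: list_all2_conv_all_nth less_Suc_eq_le simp del: upt_Suc)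
  qed
  finally show ?thesis
    unfolding mean_seq_def .
qed

lemma not_summable_if_sum_at_top:
  fixes a :: "nat \<Rightarrow> real"
  assumes "filterlim (\<lambda>N. \<Sum>n<N. a n) at_top sequentially"
  shows "\<not> summable a"
proof
  assume "summable a"
  from not_tendsto_and_filterlim_at_infinity[OF sequentially_bot summable_LIMSEQ[OF this]]
  show False
    using filterlim_at_top_imp_at_infinity[OF assms] by blast
qed

text \<open>Eventually \<open>c n\<close> exceeds 1, and from there on the terms dominate those of
  \<open>a\<close>.\<close>

lemma not_summable_mult_powr:
  fixes a c :: "nat \<Rightarrow> real"
  assumes "\<And>n. 0 < a n" "\<not> summable a" "filterlim c at_top sequentially" "0 \<le> u"
  shows "\<not> summable (\<lambda>n. a n * c n powr u)"
proof
  assume "summable (\<lambda>n. a n * c n powr u)"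
  moreover have "\<forall>\<^sub>F n in sequentially. norm (a n) \<le> a n * c n powr u"
    using filterlim_at_top_dense[THEN iffD1, OF assms(3), rule_format, of 1]
  proof eventually_elim
    case (elim n)
    then have "1 \<le> c n powr u"
      using assms(4) by (simp add: ge_one_powr_ge_zero)
    then show ?case
      using assms(1)[of n] by simp
  qed
  ultimately have "summable a"
    by (rule summable_comparison_test_ev[rotated])
  with assms(2) show False ..
qed

lemma critical_exponent:
  fixes a c :: "nat \<Rightarrow> real"
  assumes "\<And>n. 0 < a n" "\<not> summable a" "filterlim c at_top sequentially"
    and "summable (\<lambda>n. a n * c n powr (- s))"
  obtains t where "0 < t" "summable (\<lambda>n. a n * c n powr (- t))"
    "\<not> summable (\<lambda>n. a n * c n powr (1 - t))"
proof -
  define P where "P k \<longleftrightarrow> summable (\<lambda>n. a n * c n powr (real k - s))" for k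
  obtain K :: nat where "s \<le> real K"
    using real_arch_simple by blast
  then have "\<not> P K"
    using not_summable_mult_powr[OF assms(1-3)] unfolding P_def by simp
  moreover have "P 0"
    using assms(4) unfolding P_def by simp
  ultimately obtain k where k: "P k" "\<not> P (Suc k)"
    by (metis nat_induct)
  show ?thesis
  proof (rule that[of "s - real k"])
    \<comment> \<open>Otherwise the exponent \<open>real k - s\<close> would be nonnegative and the
      series in \<open>P k\<close> would diverge.\<close>
    show "0 < s - real k"
      using k(1) not_summable_mult_powr[OF assms(1-3), of "real k - s"] unfolding P_def by force
  qed (use k in \<open>simp_all add: P_def algebra_simps\<close>)
qed

theorem theorem1:
  fixes M :: "real list \<Rightarrow> real"
  assumes "mean_on {0<..} M"
    and "homogeneous_mean M"
    and "monotone_mean_on {0<..} M"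
    and "\<exists>a :: nat \<Rightarrow> real.
           (\<forall>n. a n > 0) \<and>
           filterlim (\<lambda>N. \<Sum>n<N. a n) at_top sequentially \<and>
           nearly_increasing (\<lambda>n. inverse (a n) * mean_seq M a n) \<and>
           filterlim (\<lambda>n. inverse (a n) * mean_seq M a n) at_top sequentially \<and>
           (\<exists>s :: real. s > 0 \<and> summable (\<lambda>n. a n powr (1 + s) * mean_seq M a n powr (- s)))"
  shows "\<not> weak_Hardy_on {0<..} M"
proof
  assume weak: "weak_Hardy_on {0<..} M"
  obtain a s where a: "\<And>n. 0 < a n"
    and div: "filterlim (\<lambda>N. \<Sum>n<N. a n) at_top sequentially"
    and near: "nearly_increasing (\<lambda>n. inverse (a n) * mean_seq M a n)"
    and lim: "filterlim (\<lambda>n. inverse (a n) * mean_seq M a n) at_top sequentially"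
    and summ: "summable (\<lambda>n. a n powr (1 + s) * mean_seq M a n powr (- s))"
    using assms(4) by blast
  define c where "c = (\<lambda>n. inverse (a n) * mean_seq M a n)"
  have c: "0 < c n" for n
    using near unfolding nearly_increasing_def c_def by blast
  have M_eq: "mean_seq M a n = a n * c n" for n
    using a[of n] by (simp add: c_def)
  obtain \<epsilon> where \<epsilon>: "0 < \<epsilon>" "\<And>m n. m \<le> n \<Longrightarrow> \<epsilon> * c m \<le> c n"
    using near unfolding nearly_increasing_def c_def by blast
  \<comment> \<open>Writing the mean as \<open>a n * c n\<close> makes the powers
    \<open>a n powr s\<close> and \<open>a n powr (- s)\<close> cancel.\<close>
  have "a n powr (1 + s) * mean_seq M a n powr (- s) = a n * c n powr (- s)" for n
    using a[of n] c[of n] by (simp add: M_eq powr_mult powr_add powr_minus field_simps)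
  then have "summable (\<lambda>n. a n * c n powr (- s))"
    using summ by simp
  with a not_summable_if_sum_at_top[OF div] lim[folded c_def]
  obtain t where t: "0 < t" "summable (\<lambda>n. a n * c n powr (- t))"
    "\<not> summable (\<lambda>n. a n * c n powr (1 - t))"
    by (rule critical_exponent)
  define b where "b = (\<lambda>n. a n * c n powr (- t))"
  have "0 < b n" for n
    using a[of n] c[of n] by (simp add: b_def)
  then have summ_b: "summable (mean_seq M b)"
    using weak t(2) unfolding weak_Hardy_on_def b_def by simp
  have lower: "\<epsilon> powr t * (a n * c n powr (1 - t)) \<le> mean_seq M b n" for n
  proof -
    have "(\<epsilon> powr t * c n powr (- t)) * mean_seq M a n \<le> mean_seq M b n"
    proof (rule mean_seq_scaled_le[OF assms(2,3) a])
      show "0 < \<epsilon> powr t * c n powr (- t)"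
        using \<epsilon>(1) c[of n] by simp
      fix k assume "k \<le> n"
      \<comment> \<open>The negative exponent \<open>- t\<close> reverses
        \<open>\<epsilon> * c k \<le> c n\<close>; afterwards \<open>\<epsilon> powr t\<close>
        cancels.\<close>
      have "\<epsilon> powr t * c n powr (- t) \<le> \<epsilon> powr t * (\<epsilon> * c k) powr (- t)"
        using \<epsilon>(2)[OF \<open>k \<le> n\<close>] \<epsilon>(1) c t(1) by (intro mult_left_mono powr_mono2') auto
      also have "\<dots> = c k powr (- t)"
        using \<epsilon>(1) c[of k] by (simp add: powr_mult powr_minus field_simps)
      finally show "\<epsilon> powr t * c n powr (- t) * a k \<le> b k"
        using a[of k] by (simp add: b_def mult.commute)
    qed
    moreover have "c n powr (1 - t) = c n powr (- t) * c n"
      using c[of n] by (simp add: powr_diff powr_minus field_simps)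
    ultimately show ?thesis
      by (simp add: M_eq mult_ac)
  qed
  \<comment> \<open>Comparison with the summable means of \<open>b\<close>; as the constant
    \<open>\<epsilon> powr t\<close> is nonzero, this contradicts the choice of
    \<open>t\<close>.\<close>
  have "summable (\<lambda>n. \<epsilon> powr t * (a n * c n powr (1 - t)))"
  proof (rule summable_comparison_test'[OF summ_b, of 0])
    fix n
    have "0 \<le> \<epsilon> powr t * (a n * c n powr (1 - t))"
      using a[of n] by simp
    then show "norm (\<epsilon> powr t * (a n * c n powr (1 - t))) \<le> mean_seq M b n"
      using lower[of n] by simp
  qed
  then show False
    using t(3) \<epsilon>(1) by (simp only: summable_cmult_iff) simp
qed

end
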